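(* Let $(X,\sigma)$ be a left non-degenerate braided set, $\triangleleft_\sigma$ its associated shelf operation, and $\sigma'\colon(a,b)\mapsto(b\triangleleft_\sigma a,a)$ the braiding on $X$ extracted from $\triangleleft_\sigma$. Let $J$ denote the guitar map of $(X,\sigma)$. (1) The $n$-guitar map $J\colon X^{\times n}\to X^{\times n}$ is bijective for all $n\geqslant1$. (2) $J$ satisfies the cocycle property $J(\overline a\,\overline b)=(J(\overline a)\leftthreetimes\overline b)\,J(\overline b)$ for all $\overline a,\overline b\in T(X)$, where the action $\leftthreetimes$ of $T(X)$ on itself is defined by $(a_1,\dots,a_n)\leftthreetimes\overline b=(a_1^{\overline b},\dots,a_n^{\overline b})$. (3) $J$ entwines the adjoint action and the action $\leftthreetimes$: $J(\overline a^{\,\overline b})=J(\overline a)\leftthreetimes\overline b$ for all $\overline a,\overline b\in T(X)$. (4) $J$ entwines $\sigma$ and $\sigma'$: $J\sigma_i=\sigma'_iJ$ on $X^{\times n}$ for all $1\leqslant i\leqslant n-1$. (5) The operation $\leftthreetimes$ induces an action of $SG_{(X,\sigma)}$ on $SG_{(X,\triangleleft_\sigma)}$. (6) $J$ induces a bijective cocycle $J^{SG}\colon SG_{(X,\sigma)}\to SG_{(X,\triangleleft_\sigma)}$ with respect to the $SG_{(X,\sigma)}$-action on $SG_{(X,\triangleleft_\sigma)}$ from (5); i.e. $J^{SG}$ is a bijection with $J^{SG}(gh)=(J^{SG}(g)\leftthreetimes h)\,J^{SG}(h)$.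
   Context: A braided set is a set $X$ with a (not necessarily invertible) map $\sigma\colon X\times X\to X\times X$, $\sigma(a,b)=({}^{a}b,a^b)$, satisfying the Yang--Baxter equation $(\sigma\times\mathrm{Id})(\mathrm{Id}\times\sigma)(\sigma\times\mathrm{Id})=(\mathrm{Id}\times\sigma)(\sigma\times\mathrm{Id})(\mathrm{Id}\times\sigma)$. It is left non-degenerate if for every $b\in X$ the map $a\mapsto a^b$ is bijective; then $a\mapsto b\,\tilde{\cdot}\,a$ denotes the inverse of $a\mapsto a^b$, and $a\cdot b={}^{(b\,\tilde{\cdot}\,a)}b$. The associated shelf operation is $a\triangleleft_\sigma b=(b\cdot a)^b$; it is self-distributive: $(a\triangleleft_\sigma b)\triangleleft_\sigma c=(a\triangleleft_\sigma c)\triangleleft_\sigma(b\triangleleft_\sigma c)$. $T(X)=\coprod_{i\geqslant0}X^{\times i}$, with concatenation product $\overline a\,\overline b$. The braiding extends to $T(X)$, $(\overline a,\overline b)\mapsto({}^{\overline a}\overline b,\overline a^{\,\overline b})$, by passing all strands of $\overline b$ across all strands of $\overline a$ using $\sigma$. Explicitly, for $b\in X$: ${}^{(a_1,\dots,a_n)}b={}^{a_1}(\cdots({}^{a_n}b)\cdots)$ and $(a_1,\dots,a_n)^b=(c_1,\dots,c_n)$ with $c_j=a_j^{\,b_j}$, $b_j={}^{(a_{j+1},\dots,a_n)}b$; and $\overline a^{\,(b_1,\dots,b_m)}=(\cdots(\overline a^{\,b_1})\cdots)^{b_m}$. The right action $(\overline a,\overline b)\mapsto\overline a^{\,\overline b}$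 of $T(X)$ on itself is called adjoint. In particular for $a\in X$, $a^{b_1\cdots b_m}=(\cdots(a^{b_1})\cdots)^{b_m}$. The $n$-guitar map is $J\colon X^{\times n}\to X^{\times n}$, $J(x_1,\dots,x_n)=(J_1,\dots,J_n)$ with $J_i=x_i^{x_{i+1}\cdots x_n}$ (so $J_n=x_n$); $J$ also denotes the induced map $T(X)\to T(X)$. $\sigma_i$ (resp. $\sigma'_i$) is $\sigma$ (resp. $\sigma'$) applied to the components $i,i+1$ of $X^{\times n}$. $SG_{(X,\sigma)}$ is the semigroup generated by $X$ with relations $ab={}^{a}b\,a^b$, $a,b\in X$; $SG_{(X,\triangleleft_\sigma)}$ is the semigroup generated by $X$ with relations $ab=(b\triangleleft_\sigma a)\,a$, $a,b\in X$ (i.e. the structure semigroup of $(X,\sigma')$). *)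

theory Defs
  imports Main
begin

definition lact :: "('a \<times> 'a \<Rightarrow> 'a \<times> 'a) \<Rightarrow> 'a \<Rightarrow> 'a \<Rightarrow> 'a" where
  "lact \<sigma> a b = fst (\<sigma> (a, b))"

definition ract :: "('a \<times> 'a \<Rightarrow> 'a \<times> 'a) \<Rightarrow> 'a \<Rightarrow> 'a \<Rightarrow> 'a" where
  "ract \<sigma> a b = snd (\<sigma> (a, b))"

text \<open>In all that follows, \<open>lact \<sigma> a b\<close> is the left action of \<open>a\<close> on \<open>b\<close>, written with \<open>a\<close> as a
  left superscript of \<open>b\<close>, and \<open>ract \<sigma> a b\<close> is \<open>a\<close> with right superscript \<open>b\<close>.\<close>

definition on12 :: "('a \<times> 'a \<Rightarrow> 'a \<times> 'a) \<Rightarrow> 'a \<times> 'a \<times> 'a \<Rightarrow> 'a \<times> 'a \<times> 'a" where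
  "on12 \<sigma> = (\<lambda>(a, b, c). (fst (\<sigma> (a, b)), snd (\<sigma> (a, b)), c))"

definition on23 :: "('a \<times> 'a \<Rightarrow> 'a \<times> 'a) \<Rightarrow> 'a \<times> 'a \<times> 'a \<Rightarrow> 'a \<times> 'a \<times> 'a" where
  "on23 \<sigma> = (\<lambda>(a, b, c). (a, \<sigma> (b, c)))"

locale braided_set =
  fixes X :: "'a set" and \<sigma> :: "'a \<times> 'a \<Rightarrow> 'a \<times> 'a"
  assumes closed: "p \<in> X \<times> X \<Longrightarrow> \<sigma> p \<in> X \<times> X"
    and yang_baxter: "t \<in> X \<times> X \<times> X \<Longrightarrow>
      on12 \<sigma> (on23 \<sigma> (on12 \<sigma> t)) = on23 \<sigma> (on12 \<sigma> (on23 \<sigma> t))"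

locale left_nondegenerate_braided_set = braided_set +
  assumes left_nondegenerate: "b \<in> X \<Longrightarrow> bij_betw (\<lambda>a. ract \<sigma> a b) X X"

text \<open>\<open>tdot X \<sigma> b a\<close> is \<open>b\<close> (tilde-dot) \<open>a\<close>: the inverse of \<open>\<lambda>x. ract \<sigma> x b\<close> applied to \<open>a\<close>.\<close>

definition tdot :: "'a set \<Rightarrow> ('a \<times> 'a \<Rightarrow> 'a \<times> 'a) \<Rightarrow> 'a \<Rightarrow> 'a \<Rightarrow> 'a" where
  "tdot X \<sigma> b a = inv_into X (\<lambda>x. ract \<sigma> x b) a"

definition dot :: "'a set \<Rightarrow> ('a \<times> 'a \<Rightarrow> 'a \<times> 'a) \<Rightarrow> 'a \<Rightarrow> 'a \<Rightarrow> 'a" where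
  "dot X \<sigma> a b = lact \<sigma> (tdot X \<sigma> b a) b"

definition shelf :: "'a set \<Rightarrow> ('a \<times> 'a \<Rightarrow> 'a \<times> 'a) \<Rightarrow> 'a \<Rightarrow> 'a \<Rightarrow> 'a" where
  "shelf X \<sigma> a b = ract \<sigma> (dot X \<sigma> b a) b"

definition shelf_braiding :: "'a set \<Rightarrow> ('a \<times> 'a \<Rightarrow> 'a \<times> 'a) \<Rightarrow> 'a \<times> 'a \<Rightarrow> 'a \<times> 'a" where
  "shelf_braiding X \<sigma> = (\<lambda>(a, b). (shelf X \<sigma> b a, a))"

text \<open>\<open>T(X)\<close> is \<open>lists X\<close> with concatenation \<open>@\<close>; its degree \<open>n\<close> part is the following.\<close>

definition words :: "'a set \<Rightarrow> nat \<Rightarrow> 'a list set" where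
  "words X n = {xs \<in> lists X. length xs = n}"

definition word_lact :: "('a \<times> 'a \<Rightarrow> 'a \<times> 'a) \<Rightarrow> 'a list \<Rightarrow> 'a \<Rightarrow> 'a" where
  "word_lact \<sigma> as b = foldr (lact \<sigma>) as b"

text \<open>A strand \<open>b\<close> passes the strands of a word from right to left, so the letter \<open>a\<^sub>j\<close> meets
  \<open>word_lact \<sigma> (a\<^sub>j\<^sub>+\<^sub>1, \<dots>, a\<^sub>n) b\<close>.\<close>

primrec word_ract :: "('a \<times> 'a \<Rightarrow> 'a \<times> 'a) \<Rightarrow> 'a list \<Rightarrow> 'a \<Rightarrow> 'a list" where
  "word_ract \<sigma> [] b = []"
| "word_ract \<sigma> (a # as) b = ract \<sigma> a (word_lact \<sigma> as b) # word_ract \<sigma> as b"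

definition adjoint :: "('a \<times> 'a \<Rightarrow> 'a \<times> 'a) \<Rightarrow> 'a list \<Rightarrow> 'a list \<Rightarrow> 'a list" where
  "adjoint \<sigma> as bs = foldl (word_ract \<sigma>) as bs"

definition letter_ract :: "('a \<times> 'a \<Rightarrow> 'a \<times> 'a) \<Rightarrow> 'a \<Rightarrow> 'a list \<Rightarrow> 'a" where
  "letter_ract \<sigma> a bs = foldl (ract \<sigma>) a bs"

lemma adjoint_letter: "adjoint \<sigma> [a] bs = [letter_ract \<sigma> a bs]"
  by (induction bs arbitrary: a) (simp_all add: adjoint_def letter_ract_def word_lact_def)

definition diag_act :: "('a \<times> 'a \<Rightarrow> 'a \<times> 'a) \<Rightarrow> 'a list \<Rightarrow> 'a list \<Rightarrow> 'a list" where
  "diag_act \<sigma> as bs = map (\<lambda>a. letter_ract \<sigma> a bs) as"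

primrec guitar :: "('a \<times> 'a \<Rightarrow> 'a \<times> 'a) \<Rightarrow> 'a list \<Rightarrow> 'a list" where
  "guitar \<sigma> [] = []"
| "guitar \<sigma> (x # xs) = letter_ract \<sigma> x xs # guitar \<sigma> xs"

text \<open>\<open>at_pos \<tau> i\<close> applies \<open>\<tau>\<close> to the components \<open>i\<close>, \<open>i + 1\<close> of a word, where components are
  counted from 1 (whereas \<open>!\<close> and list update count from 0).\<close>

definition at_pos :: "('a \<times> 'a \<Rightarrow> 'a \<times> 'a) \<Rightarrow> nat \<Rightarrow> 'a list \<Rightarrow> 'a list" where
  "at_pos \<tau> i xs =
     (let (c, d) = \<tau> (xs ! (i - 1), xs ! i) in xs[i - 1 := c, i := d])"

text \<open>The structure semigroup of \<open>(X, \<tau>)\<close> is the free semigroup on \<open>X\<close> (the nonempty words)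
  modulo the smallest congruence containing the defining relations. There is no unit.\<close>

definition free_sg :: "'a set \<Rightarrow> 'a list set" where
  "free_sg X = {w \<in> lists X. w \<noteq> []}"

inductive_set sg_cong :: "'a set \<Rightarrow> ('a \<times> 'a \<Rightarrow> 'a \<times> 'a) \<Rightarrow> ('a list \<times> 'a list) set"
  for X :: "'a set" and \<tau> :: "'a \<times> 'a \<Rightarrow> 'a \<times> 'a" where
  gen: "a \<in> X \<Longrightarrow> b \<in> X \<Longrightarrow> ([a, b], [lact \<tau> a b, ract \<tau> a b]) \<in> sg_cong X \<tau>"
| refl: "w \<in> free_sg X \<Longrightarrow> (w, w) \<in> sg_cong X \<tau>"
| sym: "(u, v) \<in> sg_cong X \<tau> \<Longrightarrow> (v, u) \<in> sg_cong X \<tau>"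
| trans: "(u, v) \<in> sg_cong X \<tau> \<Longrightarrow> (v, w) \<in> sg_cong X \<tau> \<Longrightarrow> (u, w) \<in> sg_cong X \<tau>"
| mult: "(u, u') \<in> sg_cong X \<tau> \<Longrightarrow> (v, v') \<in> sg_cong X \<tau> \<Longrightarrow> (u @ v, u' @ v') \<in> sg_cong X \<tau>"

definition SG :: "'a set \<Rightarrow> ('a \<times> 'a \<Rightarrow> 'a \<times> 'a) \<Rightarrow> 'a list set set" where
  "SG X \<tau> = free_sg X // sg_cong X \<tau>"

definition sg_class :: "'a set \<Rightarrow> ('a \<times> 'a \<Rightarrow> 'a \<times> 'a) \<Rightarrow> 'a list \<Rightarrow> 'a list set" where
  "sg_class X \<tau> w = sg_cong X \<tau> `` {w}"

definition sg_mult ::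
    "'a set \<Rightarrow> ('a \<times> 'a \<Rightarrow> 'a \<times> 'a) \<Rightarrow> 'a list set \<Rightarrow> 'a list set \<Rightarrow> 'a list set" where
  "sg_mult X \<tau> g h = (\<Union>u\<in>g. \<Union>v\<in>h. sg_class X \<tau> (u @ v))"

lemma sg_cong_in_free_sg:
  assumes closed: "\<And>p. p \<in> X \<times> X \<Longrightarrow> \<tau> p \<in> X \<times> X" and uv: "(u, v) \<in> sg_cong X \<tau>"
  shows "u \<in> free_sg X \<and> v \<in> free_sg X"
  using uv
proof induction
  case (gen a b)
  then have "\<tau> (a, b) \<in> X \<times> X" using closed by simp
  with gen show ?case by (auto simp: free_sg_def lact_def ract_def mem_Times_iff)
qed (auto simp: free_sg_def)

lemma equiv_sg_cong:
  assumes "\<And>p. p \<in> X \<times> X \<Longrightarrow> \<tau> p \<in> X \<times> X"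
  shows "equiv (free_sg X) (sg_cong X \<tau>)"
proof (rule equivI)
  show "sg_cong X \<tau> \<subseteq> free_sg X \<times> free_sg X"
    using sg_cong_in_free_sg[of X \<tau>] assms by auto
qed (auto intro!: refl_onI symI transI intro: sg_cong.intros)

lemma sg_mult_class:
  assumes "\<And>p. p \<in> X \<times> X \<Longrightarrow> \<tau> p \<in> X \<times> X" and "u \<in> free_sg X" "v \<in> free_sg X"
  shows "sg_mult X \<tau> (sg_class X \<tau> u) (sg_class X \<tau> v) = sg_class X \<tau> (u @ v)"
proof -
  have eq: "equiv (free_sg X) (sg_cong X \<tau>)"
    using assms(1) by (rule equiv_sg_cong)
  have "(\<lambda>u v. sg_cong X \<tau> `` {u @ v}) respects2 sg_cong X \<tau>"
    by (intro congruent2I' equiv_class_eq[OF eq] sg_cong.mult)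
  then show ?thesis
    unfolding sg_mult_def sg_class_def by (rule UN_equiv_class2[OF eq eq]) (fact assms)+
qed

text \<open>The next two definitions lift \<open>diag_act \<sigma>\<close> and \<open>guitar \<sigma>\<close> to classes, taking the union over
  all representatives. They give the induced maps exactly when the value on a class
  is the class of the value on any representative, which therefore has to be stated along with them.\<close>

definition sg_act ::
    "'a set \<Rightarrow> ('a \<times> 'a \<Rightarrow> 'a \<times> 'a) \<Rightarrow> 'a list set \<Rightarrow> 'a list set \<Rightarrow> 'a list set" where
  "sg_act X \<sigma> g h = (\<Union>u\<in>g. \<Union>v\<in>h. sg_class X (shelf_braiding X \<sigma>) (diag_act \<sigma> u v))"

definition sg_guitar :: "'a set \<Rightarrow> ('a \<times> 'a \<Rightarrow> 'a \<times> 'a) \<Rightarrow> 'a list set \<Rightarrow> 'a list set" where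
  "sg_guitar X \<sigma> g = (\<Union>u\<in>g. sg_class X (shelf_braiding X \<sigma>) (guitar \<sigma> u))"

definition semigroup_right_action ::
    "'g set \<Rightarrow> ('g \<Rightarrow> 'g \<Rightarrow> 'g) \<Rightarrow> 'm set \<Rightarrow> ('m \<Rightarrow> 'g \<Rightarrow> 'm) \<Rightarrow> bool" where
  "semigroup_right_action S mul M act \<longleftrightarrow>
     (\<forall>m\<in>M. \<forall>g\<in>S. act m g \<in> M) \<and>
     (\<forall>m\<in>M. \<forall>g\<in>S. \<forall>h\<in>S. act m (mul g h) = act (act m g) h)"

end

theory Submission
  imports Defs
begin

text \<open>
  In the two-letter case, with \<open>\<sigma> (x, a) = (y, b)\<close>, the shelf operation is built so that
  \<open>J (x, a) = (b, a)\<close> and \<open>J (y, b) = (a \<triangleleft> b, b) = \<sigma>' (b, a)\<close>. The third component of the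
  Yang--Baxter equation says that the right action of a word depends only on its class in
  \<open>SG (X, \<sigma>)\<close>; the second and third together say that this action is by shelf endomorphisms.
  Hence \<open>J\<close> respects the congruences. To reflect them, one follows a congruence
  between \<open>J u\<close> and \<open>J v\<close>, both acted on by one arbitrary word, along its
  derivation: this word absorbs the right factor of a product.
\<close>

section \<open>Calculus of words, actions and the guitar map\<close>

lemma letter_ract_Nil [simp]: "letter_ract \<sigma> a [] = a"
  and letter_ract_Cons [simp]: "letter_ract \<sigma> a (b # bs) = letter_ract \<sigma> (ract \<sigma> a b) bs"
  and letter_ract_append: "letter_ract \<sigma> a (bs @ cs) = letter_ract \<sigma> (letter_ract \<sigma> a bs) cs"
  by (simp_all add: letter_ract_def)

lemma diag_act_Nil [simp]: "diag_act \<sigma> [] bs = []"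
  and diag_act_Cons [simp]: "diag_act \<sigma> (a # as) bs = letter_ract \<sigma> a bs # diag_act \<sigma> as bs"
  and diag_act_append_left: "diag_act \<sigma> (as @ cs) bs = diag_act \<sigma> as bs @ diag_act \<sigma> cs bs"
  and diag_act_append_right: "diag_act \<sigma> as (bs @ cs) = diag_act \<sigma> (diag_act \<sigma> as bs) cs"
  and diag_act_Nil_right [simp]: "diag_act \<sigma> as [] = as"
  and length_diag_act [simp]: "length (diag_act \<sigma> as bs) = length as"
  and diag_act_eq_Nil_iff [simp]: "diag_act \<sigma> as bs = [] \<longleftrightarrow> as = []"
  by (simp_all add: diag_act_def letter_ract_append)

lemma length_guitar [simp]: "length (guitar \<sigma> as) = length as"
  by (induction as) simp_all

lemma guitar_eq_Nil_iff [simp]: "guitar \<sigma> as = [] \<longleftrightarrow> as = []"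
  by (cases as) simp_all

text \<open>A letter of \<open>as\<close> has to its right its own tail in \<open>as\<close>
  followed by \<open>bs\<close>, so acting by that tail is acting by the two words in turn. This is
  the cocycle property.\<close>

lemma guitar_append:
  "guitar \<sigma> (as @ bs) = diag_act \<sigma> (guitar \<sigma> as) bs @ guitar \<sigma> bs"
  by (induction as) (simp_all add: letter_ract_append)

lemma at_pos_append [simp]:
  "at_pos \<tau> (Suc (length ps)) (ps @ a # b # qs) = ps @ lact \<tau> a b # ract \<tau> a b # qs"
  by (simp add: at_pos_def lact_def ract_def split_beta list_update_append nth_append)

lemma lact_shelf_braiding [simp]: "lact (shelf_braiding X \<sigma>) a b = shelf X \<sigma> b a"
  and ract_shelf_braiding [simp]: "ract (shelf_braiding X \<sigma>) a b = a"
  by (simp_all add: lact_def ract_def shelf_braiding_def)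

section \<open>Representatives of classes in structure semigroups\<close>

lemma sg_class_in_SG: "w \<in> free_sg X \<Longrightarrow> sg_class X \<tau> w \<in> SG X \<tau>"
  by (simp add: SG_def sg_class_def quotientI)

lemma SG_cases:
  assumes "g \<in> SG X \<tau>"
  obtains w where "w \<in> free_sg X" "g = sg_class X \<tau> w"
  using assms by (auto simp: SG_def sg_class_def elim: quotientE)

lemma sg_class_eq_iff:
  assumes "\<And>p. p \<in> X \<times> X \<Longrightarrow> \<tau> p \<in> X \<times> X" "u \<in> free_sg X" "v \<in> free_sg X"
  shows "sg_class X \<tau> u = sg_class X \<tau> v \<longleftrightarrow> (u, v) \<in> sg_cong X \<tau>"
  using eq_equiv_class_iff[OF equiv_sg_cong[of X \<tau>] assms(2,3)] assms(1)
  by (simp add: sg_class_def)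

lemma free_sg_append: "u \<in> free_sg X \<Longrightarrow> v \<in> free_sg X \<Longrightarrow> u @ v \<in> free_sg X"
  by (simp add: free_sg_def)

section \<open>Consequences of the Yang-Baxter equation for actions of words\<close>

context braided_set
begin

lemma lact_closed: "a \<in> X \<Longrightarrow> b \<in> X \<Longrightarrow> lact \<sigma> a b \<in> X"
  and ract_closed: "a \<in> X \<Longrightarrow> b \<in> X \<Longrightarrow> ract \<sigma> a b \<in> X"
  using closed[of "(a, b)"] by (auto simp: lact_def ract_def mem_Times_iff)

text \<open>These are the second and third components of the Yang-Baxter equation at
  \<open>(a, b, c)\<close>.\<close>

lemma
  assumes "a \<in> X" "b \<in> X" "c \<in> X"
  shows yang_baxter_middle: "ract \<sigma> (lact \<sigma> a b) (lact \<sigma> (ract \<sigma> a b) c)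
      = lact \<sigma> (ract \<sigma> a (lact \<sigma> b c)) (ract \<sigma> b c)"
    and yang_baxter_right: "ract \<sigma> (ract \<sigma> a b) c
      = ract \<sigma> (ract \<sigma> a (lact \<sigma> b c)) (ract \<sigma> b c)"
  using yang_baxter[of "(a, b, c)"] assms
  by (auto simp: on12_def on23_def lact_def ract_def split_beta prod_eq_iff)

lemma letter_ract_closed: "a \<in> X \<Longrightarrow> bs \<in> lists X \<Longrightarrow> letter_ract \<sigma> a bs \<in> X"
  by (induction bs arbitrary: a) (auto simp: ract_closed)

lemma diag_act_closed: "as \<in> lists X \<Longrightarrow> bs \<in> lists X \<Longrightarrow> diag_act \<sigma> as bs \<in> lists X"
  by (induction as) (auto simp: letter_ract_closed)

lemma guitar_closed: "as \<in> lists X \<Longrightarrow> guitar \<sigma> as \<in> lists X"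
  by (induction as) (auto simp: letter_ract_closed)

lemma diag_act_free_sg: "u \<in> free_sg X \<Longrightarrow> v \<in> lists X \<Longrightarrow> diag_act \<sigma> u v \<in> free_sg X"
  by (auto simp: free_sg_def diag_act_closed)

lemma guitar_free_sg: "u \<in> free_sg X \<Longrightarrow> guitar \<sigma> u \<in> free_sg X"
  by (auto simp: free_sg_def guitar_closed)

lemma word_lact_closed: "as \<in> lists X \<Longrightarrow> b \<in> X \<Longrightarrow> word_lact \<sigma> as b \<in> X"
  by (induction as) (auto simp: word_lact_def lact_closed)

lemma word_ract_closed: "as \<in> lists X \<Longrightarrow> b \<in> X \<Longrightarrow> word_ract \<sigma> as b \<in> lists X"
  by (induction as) (auto simp: word_lact_closed ract_closed)

text \<open>The left side is the first letter of
  \<open>guitar \<sigma> (word_ract \<sigma> (a # as) b)\<close>. Each letter of \<open>as\<close>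
  costs one use of \<open>yang_baxter_right\<close>, with \<open>a\<close> changing along the
  way.\<close>

lemma letter_ract_word_ract:
  assumes "a \<in> X" "as \<in> lists X" "b \<in> X"
  shows "letter_ract \<sigma> (ract \<sigma> a (word_lact \<sigma> as b)) (word_ract \<sigma> as b)
    = ract \<sigma> (letter_ract \<sigma> a as) b"
  using assms
proof (induction as arbitrary: a)
  case Nil
  then show ?case by (simp add: word_lact_def)
next
  case (Cons c cs)
  then have "c \<in> X" "cs \<in> lists X" by auto
  have "letter_ract \<sigma> (ract \<sigma> a (word_lact \<sigma> (c # cs) b)) (word_ract \<sigma> (c # cs) b)
      = letter_ract \<sigma> (ract \<sigma> (ract \<sigma> a (lact \<sigma> c (word_lact \<sigma> cs b)))
          (ract \<sigma> c (word_lact \<sigma> cs b))) (word_ract \<sigma> cs b)"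
    by (simp add: word_lact_def)
  also have "\<dots> = letter_ract \<sigma> (ract \<sigma> (ract \<sigma> a c) (word_lact \<sigma> cs b)) (word_ract \<sigma> cs b)"
    using Cons.prems \<open>c \<in> X\<close> \<open>cs \<in> lists X\<close>
    by (subst yang_baxter_right) (auto intro: word_lact_closed)
  also have "\<dots> = ract \<sigma> (letter_ract \<sigma> a (c # cs)) b"
    using Cons.prems Cons.IH[of "ract \<sigma> a c"] \<open>c \<in> X\<close> \<open>cs \<in> lists X\<close> by (simp add: ract_closed)
  finally show ?case .
qed

lemma guitar_word_ract:
  assumes "as \<in> lists X" "b \<in> X"
  shows "guitar \<sigma> (word_ract \<sigma> as b) = diag_act \<sigma> (guitar \<sigma> as) [b]"
  using assms by (induction as) (simp_all add: letter_ract_word_ract)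

lemma guitar_adjoint:
  assumes "as \<in> lists X" "bs \<in> lists X"
  shows "guitar \<sigma> (adjoint \<sigma> as bs) = diag_act \<sigma> (guitar \<sigma> as) bs"
  using assms
proof (induction bs arbitrary: as)
  case Nil
  then show ?case by (simp add: adjoint_def)
next
  case (Cons b bs)
  then show ?case
    using diag_act_append_right[of \<sigma> "guitar \<sigma> as" "[b]" bs]
    by (simp add: adjoint_def guitar_word_ract word_ract_closed)
qed

text \<open>On a defining relation this is \<open>yang_baxter_right\<close>, read with the letter
  acted upon in first place.\<close>

lemma letter_ract_sg_cong:
  assumes "(u, v) \<in> sg_cong X \<sigma>" "a \<in> X"
  shows "letter_ract \<sigma> a u = letter_ract \<sigma> a v"
  using assms
proof (induction arbitrary: a rule: sg_cong.induct)
  case (gen b c)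
  then show ?case by (simp flip: yang_baxter_right)
next
  case (mult u u' v v')
  \<comment> \<open>The letter obtained after acting by \<open>u\<close> must lie in
    \<open>X\<close>, so that the hypothesis for the right factors applies to it.\<close>
  have "u \<in> lists X"
    using sg_cong_in_free_sg[OF closed mult.hyps(1)] by (simp add: free_sg_def)
  with mult show ?case by (metis letter_ract_append letter_ract_closed)
qed simp_all

lemma diag_act_sg_cong_right:
  assumes "(u, v) \<in> sg_cong X \<sigma>" "as \<in> lists X"
  shows "diag_act \<sigma> as u = diag_act \<sigma> as v"
  using assms by (auto simp: diag_act_def intro: letter_ract_sg_cong)

end

section \<open>The shelf operation and its compatibility with right actions\<close>

context left_nondegenerate_braided_set
begin

lemma ract_surj:
  assumes "b \<in> X" "a \<in> X"
  obtains x where "x \<in> X" "ract \<sigma> x a = b"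
  using bij_betw_imp_surj_on[OF left_nondegenerate[OF assms(2)]] assms(1) by (metis imageE)

text \<open>Undoing the right action of \<open>a\<close> on \<open>ract \<sigma> x a\<close> returns
  \<open>x\<close>, which removes the inverse from the shelf operation. By \<open>ract_surj\<close>
  every second argument in \<open>X\<close> has this form.\<close>

lemma shelf_ract:
  assumes "x \<in> X" "a \<in> X"
  shows "shelf X \<sigma> a (ract \<sigma> x a) = ract \<sigma> (lact \<sigma> x a) (ract \<sigma> x a)"
  using bij_betw_inv_into_left[OF left_nondegenerate[OF assms(2)] assms(1)]
  by (simp add: shelf_def dot_def tdot_def)

lemma shelf_closed:
  assumes "a \<in> X" "b \<in> X"
  shows "shelf X \<sigma> a b \<in> X"
  using assms by (metis ract_surj shelf_ract lact_closed ract_closed)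

lemma shelf_braiding_closed: "p \<in> X \<times> X \<Longrightarrow> shelf_braiding X \<sigma> p \<in> X \<times> X"
  by (auto simp: shelf_braiding_def shelf_closed)

text \<open>After writing \<open>b\<close> as \<open>ract \<sigma> x a\<close>, both sides come from
  letting the strand \<open>c\<close> pass \<open>x\<close> and \<open>a\<close>, before or after
  these two cross.\<close>

lemma shelf_ract_distrib:
  assumes "a \<in> X" "b \<in> X" "c \<in> X"
  shows "shelf X \<sigma> (ract \<sigma> a c) (ract \<sigma> b c) = ract \<sigma> (shelf X \<sigma> a b) c"
proof -
  obtain x where x: "x \<in> X" "b = ract \<sigma> x a"
    using assms by (metis ract_surj)
  \<comment> \<open>This is what \<open>x\<close> becomes once \<open>c\<close> has crossed
    \<open>a\<close> and then \<open>x\<close>. It plays for \<open>ract \<sigma> a c\<close> and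
    \<open>ract \<sigma> b c\<close> the role that \<open>x\<close> plays for \<open>a\<close> and
    \<open>b\<close>.\<close>
  let ?y = "ract \<sigma> x (lact \<sigma> a c)"
  have y: "?y \<in> X" "ract \<sigma> b c = ract \<sigma> ?y (ract \<sigma> a c)"
    using x assms yang_baxter_right[of x a c] by (simp_all add: ract_closed lact_closed)
  have "ract \<sigma> (shelf X \<sigma> a b) c = ract \<sigma> (ract \<sigma> (lact \<sigma> x a) b) c"
    using x assms by (simp add: shelf_ract)
  also have "\<dots> = ract \<sigma> (ract \<sigma> (lact \<sigma> x a) (lact \<sigma> b c)) (ract \<sigma> b c)"
    using x assms by (intro yang_baxter_right) (auto simp: lact_closed)
  also have "\<dots> = ract \<sigma> (lact \<sigma> ?y (ract \<sigma> a c)) (ract \<sigma> b c)"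
    using x assms by (simp add: yang_baxter_middle)
  also have "\<dots> = shelf X \<sigma> (ract \<sigma> a c) (ract \<sigma> b c)"
    using y assms by (simp add: shelf_ract ract_closed)
  finally show ?thesis by simp
qed

lemma shelf_letter_ract:
  assumes "a \<in> X" "b \<in> X" "cs \<in> lists X"
  shows "shelf X \<sigma> (letter_ract \<sigma> a cs) (letter_ract \<sigma> b cs) = letter_ract \<sigma> (shelf X \<sigma> a b) cs"
  using assms by (induction cs arbitrary: a b) (simp_all add: shelf_ract_distrib ract_closed)

section \<open>Entwining of the two braidings\<close>

text \<open>Letters of \<open>ps\<close> see congruent words to their right and so keep their
  images; \<open>qs\<close> is untouched. At the crossing itself the claim is
  \<open>shelf_ract\<close>, carried through the action of \<open>qs\<close>.\<close>

lemma guitar_braiding: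
  assumes "ps \<in> lists X" "a \<in> X" "b \<in> X" "qs \<in> lists X"
  shows "guitar \<sigma> (ps @ lact \<sigma> a b # ract \<sigma> a b # qs)
    = at_pos (shelf_braiding X \<sigma>) (Suc (length ps)) (guitar \<sigma> (ps @ a # b # qs))"
proof -
  have "(a # b # qs, lact \<sigma> a b # ract \<sigma> a b # qs) \<in> sg_cong X \<sigma>"
  \<comment> \<open>The congruence relates only nonempty words, so an empty \<open>qs\<close> cannot
    be appended by reflexivity.\<close>
  proof (cases "qs = []")
    case True
    with assms show ?thesis by (simp add: sg_cong.gen)
  next
    case False
    with assms have "qs \<in> free_sg X" by (simp add: free_sg_def)
    with sg_cong.mult[OF sg_cong.gen sg_cong.refl] assms show ?thesis by fastforce
  qed
  then have "diag_act \<sigma> (guitar \<sigma> ps) (lact \<sigma> a b # ract \<sigma> a b # qs)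
      = diag_act \<sigma> (guitar \<sigma> ps) (a # b # qs)"
    using assms by (metis diag_act_sg_cong_right guitar_closed)
  moreover have "at_pos (shelf_braiding X \<sigma>) (Suc (length ps)) (guitar \<sigma> (ps @ a # b # qs))
      = diag_act \<sigma> (guitar \<sigma> ps) (a # b # qs)
        @ shelf X \<sigma> (letter_ract \<sigma> b qs) (letter_ract \<sigma> (ract \<sigma> a b) qs)
        # letter_ract \<sigma> (ract \<sigma> a b) qs # guitar \<sigma> qs"
    \<comment> \<open>The acted-on prefix has the same length as \<open>ps\<close>, so the position
      agrees.\<close>
    using at_pos_append[of "shelf_braiding X \<sigma>" "diag_act \<sigma> (guitar \<sigma> ps) (a # b # qs)"]
    by (simp add: guitar_append)
  moreover have "shelf X \<sigma> (letter_ract \<sigma> b qs) (letter_ract \<sigma> (ract \<sigma> a b) qs)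
      = letter_ract \<sigma> (ract \<sigma> (lact \<sigma> a b) (ract \<sigma> a b)) qs"
    using assms by (simp add: shelf_letter_ract shelf_ract ract_closed)
  ultimately show ?thesis by (simp add: guitar_append)
qed

lemma guitar_at_pos:
  assumes "1 \<le> i" "i < n" "xs \<in> words X n"
  shows "guitar \<sigma> (at_pos \<sigma> i xs) = at_pos (shelf_braiding X \<sigma>) i (guitar \<sigma> xs)"
proof -
  define ps a b qs where "ps = take (i - 1) xs" and "a = xs ! (i - 1)"
    and "b = xs ! i" and "qs = drop (Suc i) xs"
  have len: "i < length xs" and xs: "xs \<in> lists X"
    using assms by (auto simp: words_def)
  have "xs = ps @ a # b # qs"
    using len assms(1) id_take_nth_drop[of "i - 1" xs] Cons_nth_drop_Suc[of i xs]
    by (simp add: ps_def a_def b_def qs_def)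
  moreover have "i = Suc (length ps)"
    using len assms(1) by (simp add: ps_def)
  ultimately show ?thesis
    using xs guitar_braiding[of ps a b qs] by simp
qed

section \<open>Bijectivity of the guitar map on words\<close>

lemma bij_betw_letter_ract: "bs \<in> lists X \<Longrightarrow> bij_betw (\<lambda>a. letter_ract \<sigma> a bs) X X"
proof (induction bs)
  case Nil
  then show ?case by (simp add: bij_betw_def)
next
  case (Cons b bs)
  then show ?case
    using bij_betw_trans[OF left_nondegenerate[of b] Cons.IH] by (simp add: comp_def)
qed

lemma letter_ract_surj:
  assumes "b \<in> X" "bs \<in> lists X"
  obtains a where "a \<in> X" "letter_ract \<sigma> a bs = b"
  using bij_betw_imp_surj_on[OF bij_betw_letter_ract[OF assms(2)]] assms(1) by (metis imageE)

lemma letter_ract_inject: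
  assumes "a \<in> X" "b \<in> X" "bs \<in> lists X"
  shows "letter_ract \<sigma> a bs = letter_ract \<sigma> b bs \<longleftrightarrow> a = b"
  using inj_on_eq_iff[OF bij_betw_imp_inj_on[OF bij_betw_letter_ract[OF assms(3)]] assms(1,2)] .

text \<open>The map is triangular: once the letters to the right are known, each letter is
  determined, because a fixed word acts injectively. The extra word \<open>bs\<close> serves the
  reflection of congruences later on.\<close>

lemma diag_act_guitar_inject:
  assumes "u \<in> lists X" "v \<in> lists X" "bs \<in> lists X"
    and "diag_act \<sigma> (guitar \<sigma> u) bs = diag_act \<sigma> (guitar \<sigma> v) bs"
  shows "u = v"
proof -
  have "length u = length v"
    using arg_cong[OF assms(4), of length] by simp
  then show ?thesis
    using assms(1,2,4)
  proof (induction u v rule: list_induct2)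
    case (Cons a u b v)
    then have "u = v" by simp
    with Cons.prems assms(3) show ?case
      by (auto simp: letter_ract_inject letter_ract_closed in_listsI)
  qed simp
qed

lemma diag_act_guitar_surj:
  assumes "w \<in> lists X" "bs \<in> lists X"
  shows "\<exists>u\<in>lists X. diag_act \<sigma> (guitar \<sigma> u) bs = w"
  using assms(1)
proof (induction w)
  case Nil
  show ?case by (rule bexI[of _ "[]"]) simp_all
next
  case (Cons c w)
  then obtain u where u: "u \<in> lists X" "diag_act \<sigma> (guitar \<sigma> u) bs = w"
    by auto
  \<comment> \<open>A letter put in front of \<open>u\<close> is acted on first by \<open>u\<close>,
    then by \<open>bs\<close>; hence the preimage of \<open>c\<close> is taken under
    \<open>u @ bs\<close>.\<close>
  with Cons.hyps assms(2) have "c \<in> X" "u @ bs \<in> lists X" by auto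
  then obtain a where "a \<in> X" "letter_ract \<sigma> a (u @ bs) = c"
    by (rule letter_ract_surj)
  with u show ?case
    by (intro bexI[of _ "a # u"]) (simp_all add: letter_ract_append)
qed

lemma bij_betw_guitar: "bij_betw (guitar \<sigma>) (words X n) (words X n)"
proof (rule bij_betwI')
  show "guitar \<sigma> u = guitar \<sigma> v \<longleftrightarrow> u = v" if "u \<in> words X n" "v \<in> words X n" for u v
    using that diag_act_guitar_inject[of u v "[]"] by (auto simp: words_def)
  show "guitar \<sigma> u \<in> words X n" if "u \<in> words X n" for u
    using that guitar_closed[of u] by (simp add: words_def)
  show "\<exists>u\<in>words X n. w = guitar \<sigma> u" if "w \<in> words X n" for w
    using that diag_act_guitar_surj[of w "[]"] by (auto simp: words_def)
qed

section \<open>The guitar map and the two congruences\<close>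

text \<open>A word acts by shelf endomorphisms (\<open>shelf_letter_ract\<close>), so it sends
  defining relations to defining relations.\<close>

lemma diag_act_sg_cong_left:
  assumes "(u, v) \<in> sg_cong X (shelf_braiding X \<sigma>)" "bs \<in> lists X"
  shows "(diag_act \<sigma> u bs, diag_act \<sigma> v bs) \<in> sg_cong X (shelf_braiding X \<sigma>)"
  using assms(1)
proof (induction rule: sg_cong.induct)
  case (gen a b)
  then show ?case
    using assms(2) sg_cong.gen[of "letter_ract \<sigma> a bs" X "letter_ract \<sigma> b bs" "shelf_braiding X \<sigma>"]
    by (simp add: shelf_letter_ract letter_ract_closed)
next
  case (refl w)
  then show ?case using assms(2) by (intro sg_cong.refl diag_act_free_sg)
next
  case (mult u u' v v')
  then show ?case by (simp add: diag_act_append_left sg_cong.mult)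
qed (erule sg_cong.sym, erule (1) sg_cong.trans)

lemma diag_act_sg_cong:
  assumes "(u, u') \<in> sg_cong X (shelf_braiding X \<sigma>)" "(v, v') \<in> sg_cong X \<sigma>"
  shows "(diag_act \<sigma> u v, diag_act \<sigma> u' v') \<in> sg_cong X (shelf_braiding X \<sigma>)"
proof -
  have "u' \<in> lists X" "v \<in> lists X"
    using sg_cong_in_free_sg[OF shelf_braiding_closed assms(1)]
      sg_cong_in_free_sg[OF closed assms(2)]
    by (auto simp: free_sg_def)
  with assms show ?thesis
    by (metis diag_act_sg_cong_left diag_act_sg_cong_right)
qed

text \<open>The images of the two sides of a defining relation form a defining relation of the shelf
  by \<open>shelf_ract\<close>. Products follow from the cocycle property and the compatibility of
  the action with both congruences.\<close>

lemma guitar_sg_cong: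
  assumes "(u, v) \<in> sg_cong X \<sigma>"
  shows "(guitar \<sigma> u, guitar \<sigma> v) \<in> sg_cong X (shelf_braiding X \<sigma>)"
  using assms
proof (induction rule: sg_cong.induct)
  case (gen a b)
  then show ?case
    using sg_cong.gen[of "ract \<sigma> a b" X b "shelf_braiding X \<sigma>"]
    by (simp add: shelf_ract ract_closed)
next
  case (mult u u' v v')
  then show ?case
    by (simp add: guitar_append sg_cong.mult diag_act_sg_cong)
qed (simp add: sg_cong.refl guitar_free_sg, erule sg_cong.sym, erule (1) sg_cong.trans)

text \<open>Lengths are preserved, so a factorisation of the image lifts to \<open>u\<close>; the
  left factor is then acted on by the right factor \<open>u2\<close> as well as by
  \<open>bs\<close>.\<close>

lemma diag_act_guitar_append_cases:
  assumes "u \<in> lists X" "diag_act \<sigma> (guitar \<sigma> u) bs = s @ t"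
  obtains u1 u2 where "u = u1 @ u2" "u1 \<in> lists X" "u2 \<in> lists X"
    "diag_act \<sigma> (guitar \<sigma> u1) (u2 @ bs) = s" "diag_act \<sigma> (guitar \<sigma> u2) bs = t"
proof -
  define u1 u2 where "u1 = take (length s) u" and "u2 = drop (length s) u"
  have "length u = length s + length t"
    using arg_cong[OF assms(2), of length] by simp
  then have "length u1 = length s" by (simp add: u1_def)
  moreover have "u = u1 @ u2" by (simp add: u1_def u2_def)
  ultimately show thesis
    using assms that[of u1 u2]
    by (simp add: guitar_append diag_act_append_left diag_act_append_right)
qed

text \<open>Only the case of empty \<open>bs\<close> is wanted in the end, but splitting a product
  lengthens the acting word, so the induction has to allow every \<open>bs\<close>.\<close>

lemma sg_cong_of_diag_act_guitar:
  assumes "(s, t) \<in> sg_cong X (shelf_braiding X \<sigma>)"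
    and "bs \<in> lists X" "u \<in> lists X" "v \<in> lists X"
    and "diag_act \<sigma> (guitar \<sigma> u) bs = s" "diag_act \<sigma> (guitar \<sigma> v) bs = t"
  shows "(u, v) \<in> sg_cong X \<sigma>"
  using assms
proof (induction arbitrary: bs u v rule: sg_cong.induct)
  case (gen c d)
  obtain a b where u: "u = [a, b]"
    using arg_cong[OF gen.prems(4), of length] by (auto simp: length_Suc_conv numeral_2_eq_2)
  with gen.prems have ab: "a \<in> X" "b \<in> X" by auto
  \<comment> \<open>Applying \<open>\<sigma>\<close> to \<open>u\<close> realises the right side of
    the relation, so injectivity identifies the result with \<open>v\<close>.\<close>
  have eq: "diag_act \<sigma> (guitar \<sigma> [lact \<sigma> a b, ract \<sigma> a b]) bs = diag_act \<sigma> (guitar \<sigma> v) bs"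
    using gen.prems(4)[symmetric] gen.prems(5) u ab
      shelf_letter_ract[OF ab(2) _ gen.prems(1), of "ract \<sigma> a b"]
    by (simp add: shelf_ract ract_closed)
  have "[lact \<sigma> a b, ract \<sigma> a b] = v"
    by (rule diag_act_guitar_inject[OF _ gen.prems(3,1) eq]) (simp add: ab lact_closed ract_closed)
  with u ab show ?case using sg_cong.gen[of a X b \<sigma>] by simp
next
  case (refl w)
  then have "u = v" using diag_act_guitar_inject by metis
  moreover have "u \<in> free_sg X" using refl by (auto simp: free_sg_def)
  ultimately show ?case by (simp add: sg_cong.refl)
next
  case (sym s t)
  then show ?case by (metis sg_cong.sym)
next
  case (trans s t w)
  have "t \<in> lists X"
    using sg_cong_in_free_sg[OF shelf_braiding_closed trans.hyps(1)] by (simp add: free_sg_def)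
  \<comment> \<open>The intermediate word needs a preimage under the same \<open>bs\<close>, which
    surjectivity supplies.\<close>
  then obtain x where "x \<in> lists X" "diag_act \<sigma> (guitar \<sigma> x) bs = t"
    using diag_act_guitar_surj trans.prems(1) by metis
  with trans show ?case by (metis sg_cong.trans)
next
  case (mult s s' t t')
  obtain u1 u2 where u: "u = u1 @ u2" "u1 \<in> lists X" "u2 \<in> lists X"
    "diag_act \<sigma> (guitar \<sigma> u1) (u2 @ bs) = s" "diag_act \<sigma> (guitar \<sigma> u2) bs = t"
    using diag_act_guitar_append_cases mult.prems(2,4) by metis
  obtain v1 v2 where v: "v = v1 @ v2" "v1 \<in> lists X" "v2 \<in> lists X"
    "diag_act \<sigma> (guitar \<sigma> v1) (v2 @ bs) = s'" "diag_act \<sigma> (guitar \<sigma> v2) bs = t'"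
    using diag_act_guitar_append_cases mult.prems(3,5) by metis
  have uv2: "(u2, v2) \<in> sg_cong X \<sigma>"
    using mult.IH(2) mult.prems(1) u v by metis
  \<comment> \<open>The left factors are acted on by \<open>u2 @ bs\<close> and
    \<open>v2 @ bs\<close>. Since \<open>u2\<close> and \<open>v2\<close> are congruent, they act
    equally, and \<open>u2 @ bs\<close> serves as the common word.\<close>
  have "diag_act \<sigma> (guitar \<sigma> v1) (u2 @ bs) = s'"
    using v diag_act_sg_cong_right[OF uv2 guitar_closed[of v1]] by (simp add: diag_act_append_right)
  then have "(u1, v1) \<in> sg_cong X \<sigma>"
    using mult.IH(1)[of "u2 @ bs" u1 v1] mult.prems(1) u v by simp
  with uv2 u v show ?case by (simp add: sg_cong.mult)
qed

section \<open>Induced action and cocycle on structure semigroups\<close>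

lemma sg_act_class:
  assumes "u \<in> free_sg X" "v \<in> free_sg X"
  shows "sg_act X \<sigma> (sg_class X (shelf_braiding X \<sigma>) u) (sg_class X \<sigma> v)
    = sg_class X (shelf_braiding X \<sigma>) (diag_act \<sigma> u v)"
proof -
  have eq: "equiv (free_sg X) (sg_cong X (shelf_braiding X \<sigma>))" "equiv (free_sg X) (sg_cong X \<sigma>)"
    by (simp_all only: equiv_sg_cong closed shelf_braiding_closed)
  have "congruent2 (sg_cong X (shelf_braiding X \<sigma>)) (sg_cong X \<sigma>)
      (\<lambda>u v. sg_cong X (shelf_braiding X \<sigma>) `` {diag_act \<sigma> u v})"
    by (intro congruent2I' equiv_class_eq[OF eq(1)] diag_act_sg_cong)
  then show ?thesis
    unfolding sg_act_def sg_class_def by (rule UN_equiv_class2[OF eq]) (fact assms)+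
qed

lemma sg_guitar_class:
  assumes "u \<in> free_sg X"
  shows "sg_guitar X \<sigma> (sg_class X \<sigma> u) = sg_class X (shelf_braiding X \<sigma>) (guitar \<sigma> u)"
proof -
  have eq: "equiv (free_sg X) (sg_cong X (shelf_braiding X \<sigma>))" "equiv (free_sg X) (sg_cong X \<sigma>)"
    by (simp_all only: equiv_sg_cong closed shelf_braiding_closed)
  have "(\<lambda>u. sg_cong X (shelf_braiding X \<sigma>) `` {guitar \<sigma> u}) respects sg_cong X \<sigma>"
    by (intro congruentI equiv_class_eq[OF eq(1)] guitar_sg_cong)
  then show ?thesis
    unfolding sg_guitar_def sg_class_def by (rule UN_equiv_class[OF eq(2)]) (fact assms)
qed

lemma semigroup_right_action_sg_act:
  "semigroup_right_action (SG X \<sigma>) (sg_mult X \<sigma>) (SG X (shelf_braiding X \<sigma>)) (sg_act X \<sigma>)"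
  unfolding semigroup_right_action_def
proof (intro conjI ballI)
  fix m g assume "m \<in> SG X (shelf_braiding X \<sigma>)" "g \<in> SG X \<sigma>"
  then obtain u v where uv: "u \<in> free_sg X" "v \<in> free_sg X"
    and m: "m = sg_class X (shelf_braiding X \<sigma>) u" and g: "g = sg_class X \<sigma> v"
    by (elim SG_cases)
  have lists: "v \<in> lists X" using uv by (simp add: free_sg_def)
  show "sg_act X \<sigma> m g \<in> SG X (shelf_braiding X \<sigma>)"
    unfolding m g by (simp only: sg_act_class uv diag_act_free_sg lists sg_class_in_SG)
  fix h assume "h \<in> SG X \<sigma>"
  then obtain w where w: "w \<in> free_sg X" and h: "h = sg_class X \<sigma> w"
    by (elim SG_cases)
  show "sg_act X \<sigma> m (sg_mult X \<sigma> g h) = sg_act X \<sigma> (sg_act X \<sigma> m g) h"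
    unfolding m g h
    by (simp only: sg_act_class sg_mult_class[OF closed] uv w diag_act_free_sg lists free_sg_append
        diag_act_append_right)
qed

text \<open>Injectivity is reflection of the congruence with no acting word, and well-definedness is
  its preservation. Surjectivity comes from words.\<close>

lemma bij_betw_sg_guitar: "bij_betw (sg_guitar X \<sigma>) (SG X \<sigma>) (SG X (shelf_braiding X \<sigma>))"
proof (rule bij_betwI')
  fix g h assume "g \<in> SG X \<sigma>" "h \<in> SG X \<sigma>"
  then obtain u v where uv: "u \<in> free_sg X" "v \<in> free_sg X"
    and g: "g = sg_class X \<sigma> u" and h: "h = sg_class X \<sigma> v"
    by (elim SG_cases)
  have "(guitar \<sigma> u, guitar \<sigma> v) \<in> sg_cong X (shelf_braiding X \<sigma>) \<longleftrightarrow> (u, v) \<in> sg_cong X \<sigma>"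
    using uv sg_cong_of_diag_act_guitar[of "guitar \<sigma> u" "guitar \<sigma> v" "[]" u v] guitar_sg_cong[of u v]
    by (auto simp: free_sg_def)
  then show "sg_guitar X \<sigma> g = sg_guitar X \<sigma> h \<longleftrightarrow> g = h"
    unfolding g h
    by (simp only: sg_guitar_class uv guitar_free_sg
        sg_class_eq_iff[OF closed] sg_class_eq_iff[OF shelf_braiding_closed])
next
  fix g assume "g \<in> SG X \<sigma>"
  then show "sg_guitar X \<sigma> g \<in> SG X (shelf_braiding X \<sigma>)"
    by (elim SG_cases) (simp only: sg_guitar_class guitar_free_sg sg_class_in_SG)
next
  fix k assume "k \<in> SG X (shelf_braiding X \<sigma>)"
  then obtain w where w: "w \<in> free_sg X" and k: "k = sg_class X (shelf_braiding X \<sigma>) w"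
    by (elim SG_cases)
  have "w \<in> lists X" using w by (simp add: free_sg_def)
  then obtain u where "u \<in> lists X" "guitar \<sigma> u = w"
    using diag_act_guitar_surj[of w "[]"] by auto
  \<comment> \<open>The guitar map sends only the empty word to the empty word, so \<open>u\<close>
    is nonempty.\<close>
  with w have "u \<in> free_sg X" "guitar \<sigma> u = w"
    by (auto simp: free_sg_def)
  then show "\<exists>g\<in>SG X \<sigma>. k = sg_guitar X \<sigma> g"
    unfolding k by (metis sg_guitar_class sg_class_in_SG)
qed

lemma sg_guitar_mult:
  assumes "g \<in> SG X \<sigma>" "h \<in> SG X \<sigma>"
  shows "sg_guitar X \<sigma> (sg_mult X \<sigma> g h)
    = sg_mult X (shelf_braiding X \<sigma>) (sg_act X \<sigma> (sg_guitar X \<sigma> g) h) (sg_guitar X \<sigma> h)"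
proof -
  obtain u v where uv: "u \<in> free_sg X" "v \<in> free_sg X"
    and g: "g = sg_class X \<sigma> u" and h: "h = sg_class X \<sigma> v"
    using assms by (elim SG_cases)
  have lists: "v \<in> lists X" using uv by (simp add: free_sg_def)
  show ?thesis
    unfolding g h
    by (simp only: sg_guitar_class sg_act_class sg_mult_class[OF closed]
        sg_mult_class[OF shelf_braiding_closed] uv lists guitar_free_sg diag_act_free_sg
        free_sg_append guitar_append)
qed

end

theorem proposition6p2:
  fixes X :: "'a set" and \<sigma> :: "'a \<times> 'a \<Rightarrow> 'a \<times> 'a"
  assumes "left_nondegenerate_braided_set X \<sigma>"
  shows
    "(\<forall>n\<ge>1. bij_betw (guitar \<sigma>) (words X n) (words X n))
   \<and> (\<forall>as\<in>lists X. \<forall>bs\<in>lists X.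
        guitar \<sigma> (as @ bs) = diag_act \<sigma> (guitar \<sigma> as) bs @ guitar \<sigma> bs)
   \<and> (\<forall>as\<in>lists X. \<forall>bs\<in>lists X.
        guitar \<sigma> (adjoint \<sigma> as bs) = diag_act \<sigma> (guitar \<sigma> as) bs)
   \<and> (\<forall>n i. 1 \<le> i \<and> i < n \<longrightarrow>
        (\<forall>xs\<in>words X n. guitar \<sigma> (at_pos \<sigma> i xs) = at_pos (shelf_braiding X \<sigma>) i (guitar \<sigma> xs)))
   \<and> ((\<forall>u\<in>free_sg X. \<forall>v\<in>free_sg X.
          sg_act X \<sigma> (sg_class X (shelf_braiding X \<sigma>) u) (sg_class X \<sigma> v) = sg_class X (shelf_braiding X \<sigma>) (diag_act \<sigma> u v))
      \<and> semigroup_right_action (SG X \<sigma>) (sg_mult X \<sigma>) (SG X (shelf_braiding X \<sigma>)) (sg_act X \<sigma>))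
   \<and> ((\<forall>u\<in>free_sg X. sg_guitar X \<sigma> (sg_class X \<sigma> u) = sg_class X (shelf_braiding X \<sigma>) (guitar \<sigma> u))
      \<and> bij_betw (sg_guitar X \<sigma>) (SG X \<sigma>) (SG X (shelf_braiding X \<sigma>))
      \<and> (\<forall>g\<in>SG X \<sigma>. \<forall>h\<in>SG X \<sigma>.
           sg_guitar X \<sigma> (sg_mult X \<sigma> g h) =
             sg_mult X (shelf_braiding X \<sigma>) (sg_act X \<sigma> (sg_guitar X \<sigma> g) h) (sg_guitar X \<sigma> h)))"
proof -
  interpret left_nondegenerate_braided_set X \<sigma> by (fact assms)
  show ?thesis
    \<comment> \<open>Eliminating the conjunction splits the range condition on \<open>i\<close>
      into the two premises of \<open>guitar_at_pos\<close>.\<close>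
    by (intro conjI ballI allI impI; (elim conjE)?;
        rule bij_betw_guitar guitar_append guitar_adjoint guitar_at_pos sg_act_class
          semigroup_right_action_sg_act sg_guitar_class bij_betw_sg_guitar sg_guitar_mult)
qed

end
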